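(* Let $\mathbf{A}\in\mathbb{R}^{m\times n}$ be a full-column-rank matrix whose rows are partitioned into $k$ nonzero blocks $\mathbf{A}_{[1]},\ldots,\mathbf{A}_{[k]}$ with $\mathbf{A}_{[i]}\in\mathbb{R}^{m_i\times n}$, let $p>2$ and $\gamma:=1-\frac{2}{p}$, and let $\overline{\mathbf{w}}\in\mathbb{R}^k_{>0}$ be the $\ell_p$ block Lewis weights of $\mathbf{A}$. Let $\mathbf{w}\in\Omega:=\{\mathbf{u}\in\mathbb{R}^k_{>0}:\sum_{i=1}^k u_i=n\}$. Then $$D_{\mathrm{KL}}(\overline{\mathbf{w}}\,\|\,\mathcal{T}(\mathbf{w}))\le\gamma\,D_{\mathrm{KL}}(\overline{\mathbf{w}}\,\|\,\mathbf{w}),$$ where $\mathcal{T}$ is the block Lewis update map and $D_{\mathrm{KL}}$ the scaled KL divergence defined in the context.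
   Context: For $\mathbf{w}\in\mathbb{R}^k_{>0}$ write $\mathbf{W}:=\operatorname{Diag}(w_1\mathbf{I}_{m_1},\ldots,w_k\mathbf{I}_{m_k})$ and $\mathbf{G}(\mathbf{w}):=\mathbf{A}^\top\mathbf{W}^{\gamma}\mathbf{A}\succ\mathbf{0}$. The block Lewis update map $\mathcal{T}:\mathbb{R}^k_{>0}\to\mathbb{R}^k_{>0}$ is $$\mathcal{T}_i(\mathbf{w}):=w_i^{\gamma}\operatorname{Tr}\left(\mathbf{A}_{[i]}\mathbf{G}(\mathbf{w})^{-1}\mathbf{A}_{[i]}^\top\right),\quad i\in[k],$$ i.e. the total leverage score of block $i$ of the matrix $\mathbf{W}^{\gamma/2}\mathbf{A}$. The $\ell_p$ block Lewis weights of $\mathbf{A}$ are the unique vector $\overline{\mathbf{w}}\in\mathbb{R}^k_{>0}$ with $\overline{\mathbf{w}}=\mathcal{T}(\overline{\mathbf{w}})$ (existence is known). Both $\overline{\mathbf{w}}$ and $\mathcal{T}(\mathbf{w})$ lie in $\Omega$. For positive vectors $\mathbf{x},\mathbf{y}\in\mathbb{R}^d_{>0}$ each with entries summing to $n$, the scaled KL divergence is $D_{\mathrm{KL}}(\mathbf{x}\,\|\,\mathbf{y}):=\sum_{i=1}^d x_i\log(x_i/y_i)$. *)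

theory Defs
  imports "HOL-Analysis.Analysis"
begin

(* The partition of the rows of A into blocks is a map b from row indices to block
   indices: block i consists of the rows j with b j = i. *)

(* The block A_[i] is kept as an m x n matrix, with the rows outside block i replaced by
   zero, since the number of rows of a matrix is a type and cannot depend on i.  For an
   n x n matrix M, block_rows A b i ** M ** transpose (block_rows A b i) is then
   A_[i] M A_[i]^T with additional zero rows and columns, so its trace is
   Tr (A_[i] M A_[i]^T). *)
definition block_rows :: "real^'n^'m \<Rightarrow> ('m \<Rightarrow> 'k) \<Rightarrow> 'k \<Rightarrow> real^'n^'m" where
  "block_rows A b i = (\<chi> j. if b j = i then A $ j else 0)"

(* Diag (u_1 I_{m_1}, ..., u_k I_{m_k}) *)
definition block_diag :: "('m \<Rightarrow> 'k) \<Rightarrow> real^'k \<Rightarrow> real^'m^'m" where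
  "block_diag b u = (\<chi> j l. if j = l then u $ b j else 0)"

(* The power W^gamma of the positive diagonal matrix W = block_diag b w is taken on the
   diagonal. *)
definition weighted_gram :: "real \<Rightarrow> real^'n^'m \<Rightarrow> ('m \<Rightarrow> 'k) \<Rightarrow> real^'k \<Rightarrow> real^'n^'n" where
  "weighted_gram \<gamma> A b w = transpose A ** block_diag b (\<chi> i. w $ i powr \<gamma>) ** A"

definition lewis_update :: "real \<Rightarrow> real^'n^'m \<Rightarrow> ('m \<Rightarrow> 'k) \<Rightarrow> real^'k \<Rightarrow> real^'k" where
  "lewis_update \<gamma> A b w = (\<chi> i. w $ i powr \<gamma> *
     trace (block_rows A b i ** matrix_inv (weighted_gram \<gamma> A b w)
              ** transpose (block_rows A b i)))"

definition block_lewis_weights :: "real \<Rightarrow> real^'n^'m \<Rightarrow> ('m \<Rightarrow> 'k) \<Rightarrow> real^'k \<Rightarrow> bool" where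
  "block_lewis_weights p A b w \<longleftrightarrow> (\<forall>i. 0 < w $ i) \<and> w = lewis_update (1 - 2 / p) A b w"

definition Omega :: "nat \<Rightarrow> (real^'k) set" where
  "Omega n = {u. (\<forall>i. 0 < u $ i) \<and> (\<Sum>i\<in>UNIV. u $ i) = real n}"

definition KL_div :: "real^'d \<Rightarrow> real^'d \<Rightarrow> real" where
  "KL_div x y = (\<Sum>i\<in>UNIV. x $ i * ln (x $ i / y $ i))"

end

theory Submission
  imports Defs
begin

text \<open>Let \<open>\<tau>\<^sub>i\<close> and \<open>\<sigma>\<^sub>i\<close> be the traces of \<open>A\<^sub>i G(w)\<^sup>-\<^sup>1 A\<^sub>i\<^sup>T\<close> and \<open>A\<^sub>i G(v)\<^sup>-\<^sup>1 A\<^sub>i\<^sup>T\<close>, where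
  \<open>v\<close> is the Lewis weight vector. Since \<open>v\<^sub>i = v\<^sub>i\<^sup>\<gamma> \<sigma>\<^sub>i\<close>, the claim says that
  \<open>\<Sum> v\<^sub>i ln (\<tau>\<^sub>i / \<sigma>\<^sub>i) \<ge> 0\<close>. The Cauchy-Schwarz inequality for the form \<open>G(w)\<close> bounds
  \<open>\<sigma>\<^sub>i / \<tau>\<^sub>i\<close> by the trace of \<open>A\<^sub>i G(v)\<^sup>-\<^sup>1 G(w) G(v)\<^sup>-\<^sup>1 A\<^sub>i\<^sup>T\<close> divided by \<open>\<sigma>\<^sub>i\<close>. Summed with
  the weights \<open>v\<^sub>i\<close>, these bounds add up to the trace of \<open>G(v)\<^sup>-\<^sup>1 G(w)\<close>, which is
  \<open>\<Sum> w\<^sub>i\<^sup>\<gamma> v\<^sub>i\<^sup>1\<^sup>-\<^sup>\<gamma> \<le> n\<close> by weighted AM-GM; conclude with \<open>ln x \<ge> 1 - 1 / x\<close>.\<close>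

text \<open>The padded zero rows add nothing to the diagonal. Block traces thereby become sums of
  quadratic forms in the rows of \<open>A\<close>.\<close>

lemma trace_block_rows:
  fixes A :: "real^'n^'m" and b :: "'m \<Rightarrow> 'k::finite" and C :: "real^'n^'n"
  shows "trace (block_rows A b i ** C ** transpose (block_rows A b i))
    = (\<Sum>j | b j = i. A $ j \<bullet> (C *v A $ j))"
proof -
  have "(block_rows A b i ** (C ** transpose (block_rows A b i))) $ j $ j
      = (if b j = i then A $ j \<bullet> (C *v A $ j) else 0)" for j
    by (simp add: block_rows_def matrix_matrix_mult_def
        matrix_vector_mult_def transpose_def inner_vec_def)
  then show ?thesis
    unfolding trace_def by (simp add: sum.If_cases flip: matrix_mul_assoc)
qed

lemma weighted_gram_nth:
  "weighted_gram \<gamma> A b w $ r $ s = (\<Sum>j\<in>UNIV. w $ b j powr \<gamma> * A $ j $ r * A $ j $ s)"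
  by (simp add: weighted_gram_def block_diag_def matrix_matrix_mult_def transpose_def
      if_distrib sum.delta mult_ac cong: if_cong)

lemma inner_weighted_gram:
  "x \<bullet> (weighted_gram \<gamma> A b w *v y) = (\<Sum>j\<in>UNIV. w $ b j powr \<gamma> * (A $ j \<bullet> x) * (A $ j \<bullet> y))"
proof -
  have "x \<bullet> (weighted_gram \<gamma> A b w *v y)
      = (\<Sum>r\<in>UNIV. \<Sum>s\<in>UNIV. \<Sum>j\<in>UNIV. w $ b j powr \<gamma> * (A $ j $ r * x $ r) * (A $ j $ s * y $ s))"
    by (simp add: inner_vec_def matrix_vector_mult_def weighted_gram_nth
        sum_distrib_left sum_distrib_right mult_ac)
  also have "\<dots> = (\<Sum>r\<in>UNIV. \<Sum>j\<in>UNIV. \<Sum>s\<in>UNIV. w $ b j powr \<gamma> * (A $ j $ r * x $ r) * (A $ j $ s * y $ s))"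
    by (intro sum.cong refl sum.swap)
  also have "\<dots> = (\<Sum>j\<in>UNIV. \<Sum>r\<in>UNIV. \<Sum>s\<in>UNIV. w $ b j powr \<gamma> * (A $ j $ r * x $ r) * (A $ j $ s * y $ s))"
    by (rule sum.swap)
  also have "\<dots> = (\<Sum>j\<in>UNIV. w $ b j powr \<gamma> * (A $ j \<bullet> x) * (A $ j \<bullet> y))"
    by (simp add: inner_vec_def sum_distrib_left sum_distrib_right mult_ac)
  finally show ?thesis .
qed

lemma transpose_weighted_gram [simp]:
  "transpose (weighted_gram \<gamma> A b w) = weighted_gram \<gamma> A b w"
  by (simp add: vec_eq_iff transpose_def weighted_gram_nth mult_ac)

text \<open>The Gram matrix is a weighted sum of the rank-one matrices of the rows, and the weight
  is constant on each block. This collapses a weighted sum of block traces into a single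
  trace.\<close>

lemma trace_mult_weighted_gram:
  fixes b :: "'m::finite \<Rightarrow> 'k::finite"
  shows "trace (C ** weighted_gram \<gamma> A b w)
    = (\<Sum>i\<in>UNIV. w $ i powr \<gamma> * trace (block_rows A b i ** C ** transpose (block_rows A b i)))"
proof -
  have "trace (C ** weighted_gram \<gamma> A b w)
      = (\<Sum>r\<in>UNIV. \<Sum>s\<in>UNIV. \<Sum>j\<in>UNIV. w $ b j powr \<gamma> * (A $ j $ r * (C $ r $ s * A $ j $ s)))"
    by (simp add: trace_def matrix_matrix_mult_def weighted_gram_nth sum_distrib_left mult_ac)
  also have "\<dots> = (\<Sum>r\<in>UNIV. \<Sum>j\<in>UNIV. \<Sum>s\<in>UNIV. w $ b j powr \<gamma> * (A $ j $ r * (C $ r $ s * A $ j $ s)))"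
    by (intro sum.cong refl sum.swap)
  also have "\<dots> = (\<Sum>j\<in>UNIV. \<Sum>r\<in>UNIV. \<Sum>s\<in>UNIV. w $ b j powr \<gamma> * (A $ j $ r * (C $ r $ s * A $ j $ s)))"
    by (rule sum.swap)
  also have "\<dots> = (\<Sum>j\<in>UNIV. w $ b j powr \<gamma> * (A $ j \<bullet> (C *v A $ j)))"
    by (simp add: inner_vec_def matrix_vector_mult_def sum_distrib_left)
  also have "\<dots> = (\<Sum>i\<in>UNIV. \<Sum>j | b j = i. w $ b j powr \<gamma> * (A $ j \<bullet> (C *v A $ j)))"
    using sum.group[of UNIV UNIV b "\<lambda>j. w $ b j powr \<gamma> * (A $ j \<bullet> (C *v A $ j))"] by simp
  finally show ?thesis
    by (simp add: trace_block_rows sum_distrib_left)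
qed

lemma weighted_gram_nonneg: "0 \<le> x \<bullet> (weighted_gram \<gamma> A b w *v x)"
  by (auto simp: inner_weighted_gram mult.assoc intro!: sum_nonneg)

lemma weighted_gram_pos:
  assumes "rank (A :: real^'n^'m) = CARD('n)" and "\<And>i. 0 < w $ i" and "x \<noteq> 0"
  shows "0 < x \<bullet> (weighted_gram \<gamma> A b w *v x)"
proof -
  have "inj ((*v) A)"
    using assms(1) by (simp add: full_rank_injective)
  then have "A *v x \<noteq> 0"
    using \<open>x \<noteq> 0\<close> by (metis injD matrix_vector_mult_0_right)
  then obtain j where "A $ j \<bullet> x \<noteq> 0"
    by (auto simp: vec_eq_iff matrix_vector_mult_def inner_vec_def)
  moreover have "0 < w $ b j powr \<gamma>"
    using assms(2)[of "b j"] by simp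
  ultimately show ?thesis
    unfolding inner_weighted_gram
    by (intro sum_pos2[of _ j]) (auto simp: mult.assoc simp flip: power2_eq_square)
qed

lemma invertible_weighted_gram:
  assumes "rank (A :: real^'n^'m) = CARD('n)" and "\<And>i. 0 < w $ i"
  shows "invertible (weighted_gram \<gamma> A b w)"
proof -
  have "x = 0" if "weighted_gram \<gamma> A b w *v x = 0" for x
    using weighted_gram_pos[OF assms, of x \<gamma> b] that by fastforce
  then show ?thesis
    by (meson invertible_left_inverse matrix_left_invertible_ker)
qed

lemma matrix_inv_inverse:
  fixes M :: "real^'n^'n"
  assumes "invertible M"
  shows matrix_inv_right: "M ** matrix_inv M = mat 1"
    and matrix_inv_left: "matrix_inv M ** M = mat 1"
  using someI_ex[OF assms[unfolded invertible_def]] by (simp_all add: matrix_inv_def)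

lemma transpose_matrix_inv:
  fixes M :: "real^'n^'n"
  assumes "invertible M" and "transpose M = M"
  shows "transpose (matrix_inv M) = matrix_inv M"
proof -
  have "transpose (matrix_inv M) ** M = mat 1"
    by (metis assms matrix_inv_right matrix_transpose_mul transpose_mat)
  then have "transpose (matrix_inv M) ** M ** matrix_inv M = matrix_inv M"
    by simp
  then show ?thesis
    by (simp add: matrix_inv_right[OF assms(1)] flip: matrix_mul_assoc)
qed

lemma trace_block_rows_inv_pos:
  fixes b :: "'m::finite \<Rightarrow> 'k::finite"
  assumes "rank (A :: real^'n^'m) = CARD('n)" and "\<And>i. 0 < w $ i" and "block_rows A b i \<noteq> 0"
  shows "0 < trace (block_rows A b i ** matrix_inv (weighted_gram \<gamma> A b w)
    ** transpose (block_rows A b i))"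
proof -
  let ?G = "weighted_gram \<gamma> A b w"
  have GH: "?G *v (matrix_inv ?G *v a) = a" for a
    by (simp add: matrix_vector_mul_assoc matrix_inv_right invertible_weighted_gram assms)
  \<comment> \<open>With \<open>y = matrix_inv ?G *v a\<close> the form equals
    \<open>y \<bullet> (?G *v y)\<close>, so positive definiteness passes to the inverse.\<close>
  have pos: "0 < a \<bullet> (matrix_inv ?G *v a)" if "a \<noteq> 0" for a
  proof -
    have "matrix_inv ?G *v a \<noteq> 0"
      using GH[of a] that by auto
    from weighted_gram_pos[OF assms(1,2) this, of \<gamma> b] show ?thesis
      by (simp add: GH inner_commute)
  qed
  have nonneg: "0 \<le> a \<bullet> (matrix_inv ?G *v a)" for a
    using pos[of a] by (cases "a = 0") auto
  obtain j where "b j = i" "A $ j \<noteq> 0"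
    using assms(3) by (auto simp: block_rows_def vec_eq_iff split: if_splits)
  then show ?thesis
    unfolding trace_block_rows by (intro sum_pos2[of _ j]) (auto simp: pos nonneg)
qed

text \<open>The quadratic \<open>c \<mapsto> \<Sum>\<^sub>j (H a\<^sub>j - c K a\<^sub>j)\<^sup>T G (H a\<^sub>j - c K a\<^sub>j)\<close>, with \<open>H\<close> the inverse of \<open>G\<close>,
  is nonnegative.\<close>

lemma trace_block_rows_quadratic:
  fixes b :: "'m::finite \<Rightarrow> 'k::finite" and G H K :: "real^'n^'n"
  assumes GH: "G ** H = mat 1" and sym: "transpose G = G" "transpose K = K"
    and nonneg: "\<And>x. 0 \<le> x \<bullet> (G *v x)"
  shows "0 \<le> trace (block_rows A b i ** H ** transpose (block_rows A b i))
    - 2 * c * trace (block_rows A b i ** K ** transpose (block_rows A b i))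
    + c\<^sup>2 * trace (block_rows A b i ** (K ** G ** K) ** transpose (block_rows A b i))"
proof -
  have eq: "(H *v a - c *\<^sub>R (K *v a)) \<bullet> (G *v (H *v a - c *\<^sub>R (K *v a)))
     = a \<bullet> (H *v a) - 2 * c * (a \<bullet> (K *v a)) + c\<^sup>2 * (a \<bullet> ((K ** G ** K) *v a))" for a
  proof -
    have GHa: "G *v (H *v a) = a"
      by (simp add: matrix_vector_mul_assoc GH)
    \<comment> \<open>Symmetry moves \<open>G\<close> onto \<open>H *v a\<close>, where the two
      cancel, so the cross term depends on \<open>K\<close> alone.\<close>
    have "(H *v a) \<bullet> (G *v (K *v a)) = a \<bullet> (K *v a)"
      by (metis GHa dot_lmul_matrix sym(1) transpose_matrix_vector)
    moreover have "(K *v a) \<bullet> (G *v (K *v a)) = a \<bullet> ((K ** G ** K) *v a)"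
      by (metis dot_lmul_matrix sym(2) transpose_matrix_vector matrix_vector_mul_assoc)
    ultimately show ?thesis
      by (simp add: matrix_vector_mult_diff_distrib matrix_vector_mult_scaleR GHa
          inner_diff inner_commute[of _ a] power2_eq_square algebra_simps)
  qed
  have "0 \<le> (\<Sum>j | b j = i. A $ j \<bullet> (H *v A $ j) - 2 * c * (A $ j \<bullet> (K *v A $ j))
      + c\<^sup>2 * (A $ j \<bullet> ((K ** G ** K) *v A $ j)))"
    by (intro sum_nonneg) (metis eq nonneg)
  then show ?thesis
    unfolding trace_block_rows by (simp add: sum.distrib sum_subtractf sum_distrib_left)
qed

theorem lemma2p1:
  fixes A :: "real^'n^'m" and b :: "'m \<Rightarrow> 'k::finite"
    and p \<gamma> :: real and wbar w :: "real^'k"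
  assumes "rank A = CARD('n)"
    and "\<And>i. block_rows A b i \<noteq> 0"
    and "p > 2" and "\<gamma> = 1 - 2 / p"
    and "block_lewis_weights p A b wbar"
    and "w \<in> Omega CARD('n)"
  shows "KL_div wbar (lewis_update \<gamma> A b w) \<le> \<gamma> * KL_div wbar w"
proof -
  have \<gamma>: "0 < \<gamma>" "\<gamma> < 1"
    using assms(3,4) by simp_all
  have v: "0 < wbar $ i" and w: "0 < w $ i" for i
    using assms(5,6) by (auto simp: block_lewis_weights_def Omega_def)
  have sum_w: "(\<Sum>i\<in>UNIV. w $ i) = real CARD('n)"
    using assms(6) by (simp add: Omega_def)
  define G where "G = weighted_gram \<gamma> A b w"
  define Gv where "Gv = weighted_gram \<gamma> A b wbar"
  define T where "T C i = trace (block_rows A b i ** C ** transpose (block_rows A b i))" for C i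
  define \<tau> \<sigma> where "\<tau> = T (matrix_inv G)" and "\<sigma> = T (matrix_inv Gv)"
  define \<rho> where "\<rho> = T (matrix_inv Gv ** G ** matrix_inv Gv)"
  have inv: "invertible G" "invertible Gv"
    unfolding G_def Gv_def using invertible_weighted_gram assms(1) v w by blast+
  have pos: "0 < \<tau> i" "0 < \<sigma> i" for i
    unfolding \<tau>_def \<sigma>_def T_def G_def Gv_def
    using trace_block_rows_inv_pos assms(1,2) v w by blast+
  have fixpoint: "wbar $ i = wbar $ i powr \<gamma> * \<sigma> i" for i
  proof -
    have "wbar = lewis_update \<gamma> A b wbar"
      using assms(4,5) by (simp add: block_lewis_weights_def)
    then have "wbar $ i = lewis_update \<gamma> A b wbar $ i"
      by simp
    then show ?thesis
      by (simp add: lewis_update_def \<sigma>_def T_def Gv_def)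
  qed
  \<comment> \<open>The normalisation comes from the fixed-point equation: the leverage scores add
    up to the trace of the identity.\<close>
  have sum_v: "(\<Sum>i\<in>UNIV. wbar $ i) = real CARD('n)"
  proof -
    have "(\<Sum>i\<in>UNIV. wbar $ i) = (\<Sum>i\<in>UNIV. wbar $ i powr \<gamma> * \<sigma> i)"
      using fixpoint by simp
    also have "\<dots> = trace (matrix_inv Gv ** Gv)"
      by (simp add: trace_mult_weighted_gram \<sigma>_def T_def Gv_def)
    also have "\<dots> = real CARD('n)"
      by (simp add: matrix_inv_left inv trace_I)
    finally show ?thesis .
  qed
  have cauchy: "\<sigma> i / \<tau> i \<le> \<rho> i / \<sigma> i" for i
  proof -
    have "transpose G = G" "transpose (matrix_inv Gv) = matrix_inv Gv"
      using transpose_matrix_inv[OF inv(2)] by (simp_all add: G_def Gv_def)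
    moreover have "0 \<le> x \<bullet> (G *v x)" for x
      by (simp add: G_def weighted_gram_nonneg)
    \<comment> \<open>The choice \<open>c = \<tau> i / \<sigma> i\<close> merges the first two terms
      into \<open>- \<tau> i\<close> and avoids dividing by \<open>\<rho> i\<close>.\<close>
    ultimately have "0 \<le> \<tau> i - 2 * (\<tau> i / \<sigma> i) * \<sigma> i + (\<tau> i / \<sigma> i)\<^sup>2 * \<rho> i"
      unfolding \<tau>_def \<sigma>_def \<rho>_def T_def
      by (intro trace_block_rows_quadratic matrix_inv_right inv)
    then have "\<tau> i \<le> (\<tau> i / \<sigma> i)\<^sup>2 * \<rho> i"
      using pos[of i] by simp
    then show ?thesis
      using pos[of i] by (simp add: field_simps power2_eq_square)
  qed
  have "(\<Sum>i\<in>UNIV. wbar $ i * (\<sigma> i / \<tau> i)) \<le> (\<Sum>i\<in>UNIV. wbar $ i powr \<gamma> * \<rho> i)"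
  proof (rule sum_mono)
    fix i
    have "wbar $ i * (\<sigma> i / \<tau> i) \<le> wbar $ i * (\<rho> i / \<sigma> i)"
      using cauchy v[of i] by (intro mult_left_mono) auto
    \<comment> \<open>The fixed-point equation cancels \<open>\<sigma> i\<close> and leaves exactly
      the weights of \<open>Gv\<close>, so the sum becomes a trace in which \<open>Gv\<close>
      removes one inverse.\<close>
    also have "\<dots> = wbar $ i powr \<gamma> * \<rho> i"
      using pos[of i] by (subst fixpoint) simp
    finally show "wbar $ i * (\<sigma> i / \<tau> i) \<le> wbar $ i powr \<gamma> * \<rho> i" .
  qed
  also have "\<dots> = trace (matrix_inv Gv ** G ** matrix_inv Gv ** Gv)"
    by (simp add: trace_mult_weighted_gram \<rho>_def T_def Gv_def)
  also have "\<dots> = trace (matrix_inv Gv ** G)"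
    by (simp add: matrix_inv_left inv flip: matrix_mul_assoc)
  also have "\<dots> = (\<Sum>i\<in>UNIV. w $ i powr \<gamma> * \<sigma> i)"
    by (simp add: trace_mult_weighted_gram \<sigma>_def T_def G_def)
  also have "\<dots> \<le> (\<Sum>i\<in>UNIV. \<gamma> * w $ i + (1 - \<gamma>) * wbar $ i)"
  proof (rule sum_mono)
    fix i
    \<comment> \<open>The exponents now add up to 1, so Young's inequality gives a bound linear in
      \<open>w\<close> and \<open>wbar\<close>, both of total \<open>CARD('n)\<close>.\<close>
    have "\<sigma> i = wbar $ i powr (1 - \<gamma>)"
      using fixpoint[of i] v[of i] by (simp add: powr_diff field_simps)
    then show "w $ i powr \<gamma> * \<sigma> i \<le> \<gamma> * w $ i + (1 - \<gamma>) * wbar $ i"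
      using Youngs_inequality_0[of \<gamma> "1 - \<gamma>" "w $ i" "wbar $ i"] v w \<gamma> by simp
  qed
  also have "\<dots> = real CARD('n)"
    by (simp add: sum.distrib sum_distrib_left[symmetric] sum_w sum_v) (simp add: algebra_simps)
  finally have ratio: "(\<Sum>i\<in>UNIV. wbar $ i * (\<sigma> i / \<tau> i)) \<le> real CARD('n)" .
  have "KL_div wbar (lewis_update \<gamma> A b w)
      \<le> (\<Sum>i\<in>UNIV. \<gamma> * (wbar $ i * ln (wbar $ i / w $ i)) + (wbar $ i * (\<sigma> i / \<tau> i) - wbar $ i))"
    unfolding KL_div_def
  proof (rule sum_mono)
    fix i
    have upd: "lewis_update \<gamma> A b w $ i = w $ i powr \<gamma> * \<tau> i"
      by (simp add: lewis_update_def \<tau>_def T_def G_def)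
    \<comment> \<open>Taking logarithms in the fixed-point equation splits the left-hand summand
      into the desired \<gamma>-multiple and an error
      \<open>ln (\<sigma> i / \<tau> i)\<close>.\<close>
    have "ln (wbar $ i) = \<gamma> * ln (wbar $ i) + ln (\<sigma> i)"
      using v[of i] pos[of i] by (subst fixpoint) (simp add: ln_mult ln_powr)
    then have "ln (wbar $ i / lewis_update \<gamma> A b w $ i)
        = \<gamma> * ln (wbar $ i / w $ i) + ln (\<sigma> i / \<tau> i)"
      using v[of i] w[of i] pos[of i]
      by (simp add: upd ln_div ln_mult ln_powr algebra_simps)
    also have "\<dots> \<le> \<gamma> * ln (wbar $ i / w $ i) + (\<sigma> i / \<tau> i - 1)"
      using pos[of i] by (intro add_left_mono ln_le_minus_one) simp
    finally have "wbar $ i * ln (wbar $ i / lewis_update \<gamma> A b w $ i)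
        \<le> wbar $ i * (\<gamma> * ln (wbar $ i / w $ i) + (\<sigma> i / \<tau> i - 1))"
      using v[of i] by (intro mult_left_mono) auto
    then show "wbar $ i * ln (wbar $ i / lewis_update \<gamma> A b w $ i)
        \<le> \<gamma> * (wbar $ i * ln (wbar $ i / w $ i)) + (wbar $ i * (\<sigma> i / \<tau> i) - wbar $ i)"
      by (simp add: algebra_simps)
  qed
  \<comment> \<open>The linearised errors sum to the gap in \<open>ratio\<close>, which is at most
    zero.\<close>
  also have "\<dots> = \<gamma> * KL_div wbar w + ((\<Sum>i\<in>UNIV. wbar $ i * (\<sigma> i / \<tau> i)) - real CARD('n))"
    by (simp only: KL_div_def sum.distrib sum_subtractf sum_distrib_left[symmetric] sum_v)
  finally show ?thesis
    using ratio by simp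
qed

end
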